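(* Let $\mathfrak{T}$ be the operator on $x+x^2\mathbb{C}[[x]]$ given by $\mathfrak{T}f=f/f'$. Let $k\in\mathbb{N}$, $k\ge1$, and $f\in x+x^2\mathbb{C}[[x]]$. Then: (1) if $\mathfrak{T}^{2k}f=f$, then $\mathfrak{T}^2f=f$ and there exists $p\in\mathbb{C}$ such that $f(x)=\frac{e^{px}-1}{p}$ (where $p$ may be $0$, in which case this means $f(x)=x$); (2) if $\mathfrak{T}^{2k+1}f=f$, then $\mathfrak{T}f=f$, i.e. $f(x)=x$.
   Context: $x+x^2\mathbb{C}[[x]]$ is the set of formal power series with zero constant term and linear coefficient $1$; $f'$ is the formal derivative, and $\mathfrak{T}^j$ denotes the $j$-fold iterate of $\mathfrak{T}$. *)

theory Defs
  imports "HOL-Computational_Algebra.Formal_Power_Series"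
begin

definition tangent_to_id :: "complex fps set" where
  "tangent_to_id = {f. fps_nth f 0 = 0 \<and> fps_nth f 1 = 1}"

(* On tangent_to_id the derivative has constant term 1, so f / fps_deriv f is
   f times the inverse of a unit of C[[x]]. *)
definition frakT :: "complex fps \<Rightarrow> complex fps" where
  "frakT f = f / fps_deriv f"

lemma frakT_in_tangent_to_id:
  assumes "f \<in> tangent_to_id"
  shows "frakT f \<in> tangent_to_id"
  using assms
  by (simp add: tangent_to_id_def frakT_def fps_divide_unit fps_mult_nth_1)

definition exp_series :: "complex \<Rightarrow> complex fps" where
  "exp_series p = (if p = 0 then fps_X else (fps_exp p - 1) / fps_const p)"

end

theory Submission
  imports Defs
begin

unbundle fps_syntax

text \<open>
  The \<open>n\<close>-th coefficient of \<open>frakT f\<close> is \<open>(1 - n) * f\<^sub>n\<close> plus a polynomial in the lower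
  coefficients of \<open>f\<close>. Since \<open>\<bar>1 - n\<bar> > 1\<close> for \<open>n \<ge> 3\<close>, a fixed point of any positive iterate is
  determined by its quadratic coefficient, and \<open>exp_series p\<close>, whose quadratic coefficient is \<open>p / 2\<close>,
  is mapped to \<open>exp_series (- p)\<close> and hence is such a fixed point for every even iterate.
  An odd iterate negates the quadratic coefficient, which must therefore vanish at a fixed point.
\<close>

lemma fps_mult_nth_lowest:
  fixes a b :: "'a::comm_semiring_1 fps"
  assumes "\<And>m. m < n \<Longrightarrow> a $ m = 0"
  shows "(a * b) $ n = a $ n * b $ 0"
proof -
  have "(a * b) $ n = (\<Sum>i\<in>{0..n}. if i = n then a $ n * b $ 0 else 0)"
    unfolding fps_mult_nth by (rule sum.cong) (use assms in auto)
  then show ?thesis by simp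
qed

lemma frakT_mult_deriv:
  assumes "f \<in> tangent_to_id"
  shows "frakT f * fps_deriv f = f"
  using assms
  by (simp add: frakT_def tangent_to_id_def fps_divide_unit mult.assoc inverse_mult_eq_1)

lemma frakT_unique:
  assumes "f \<in> tangent_to_id" and "g * fps_deriv f = f"
  shows "frakT f = g"
proof -
  have "fps_deriv f \<noteq> 0"
    using assms(1) by (auto simp: tangent_to_id_def fps_eq_iff intro!: exI[of _ 0])
  then show ?thesis
    using assms frakT_mult_deriv[OF assms(1)] by (metis mult_right_cancel)
qed

text \<open>With \<open>h = f - g\<close>, subtracting the defining identities of
  \<open>frakT f\<close> and \<open>frakT g\<close> gives \<open>(frakT f - frakT g) * fps_deriv f =
  h - frakT g * fps_deriv h\<close>. Since \<open>frakT g\<close> starts with \<open>x\<close>, the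
  right side agrees with \<open>h - x * fps_deriv h\<close> up to degree \<open>n\<close>.\<close>

lemma frakT_nth_diff:
  assumes "f \<in> tangent_to_id" and "g \<in> tangent_to_id"
    and eq: "\<And>m. m < n \<Longrightarrow> f $ m = g $ m"
    and "m \<le> n"
  shows "frakT f $ m - frakT g $ m = (1 - of_nat m) * (f $ m - g $ m)"
proof -
  define h where "h = f - g"
  define d where "d = frakT f - frakT g"
  define E where "E = h - frakT g * fps_deriv h"
  have h0: "h $ i = 0" if "i < n" for i
    using that eq by (simp add: h_def)
  have Tg: "frakT g $ 0 = 0" "frakT g $ 1 = 1"
    using frakT_in_tangent_to_id[OF assms(2)] by (auto simp: tangent_to_id_def)
  have E: "E $ i = (1 - of_nat i) * h $ i" if "i \<le> n" for i
  proof (cases i)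
    case 0
    then show ?thesis by (simp add: E_def Tg)
  next
    case (Suc j)
    \<comment> \<open>Terms with \<open>l < j\<close> vanish because \<open>h\<close> is zero below
      degree \<open>n\<close>, the term \<open>l = i\<close> because \<open>frakT g\<close> has no
      constant term.\<close>
    have "(fps_deriv h * frakT g) $ i
          = (\<Sum>l\<in>{0..i}. if l = j then of_nat i * h $ i else 0)"
      unfolding fps_mult_nth
    proof (rule sum.cong)
      fix l assume l: "l \<in> {0..i}"
      then consider "l < j" | "l = j" | "l = i" using Suc by force
      then show "fps_deriv h $ l * frakT g $ (i - l) = (if l = j then of_nat i * h $ i else 0)"
        by cases (use Suc that Tg h0 in auto)
    qed simp
    then show ?thesis using Suc by (simp add: E_def algebra_simps)
  qed
  have f': "fps_deriv f $ 0 = 1"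
    using assms(1) by (simp add: tangent_to_id_def)
  have "d * fps_deriv f = E"
    using frakT_mult_deriv[OF assms(1)] frakT_mult_deriv[OF assms(2)]
    by (simp add: d_def E_def h_def algebra_simps)
  then have d: "d = E * inverse (fps_deriv f)"
    using f' by (metis mult.assoc mult.commute inverse_mult_eq_1 mult.right_neutral zero_neq_one)
  \<comment> \<open>\<open>E\<close> vanishes below degree \<open>m\<close>, so only the constant
    term 1 of the inverse contributes.\<close>
  have "d $ m = E $ m * inverse (fps_deriv f) $ 0"
    unfolding d by (rule fps_mult_nth_lowest) (use E h0 assms(4) in simp)
  then show ?thesis
    using f' E[OF assms(4)] by (simp add: d_def h_def)
qed

lemma frakT_funpow_in_tangent_to_id:
  assumes "f \<in> tangent_to_id"
  shows "(frakT ^^ j) f \<in> tangent_to_id"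
  by (induction j) (auto simp: assms frakT_in_tangent_to_id)

lemma frakT_funpow_nth_diff:
  assumes "f \<in> tangent_to_id" and "g \<in> tangent_to_id"
    and "\<And>m. m < n \<Longrightarrow> f $ m = g $ m"
    and "m \<le> n"
  shows "(frakT ^^ j) f $ m - (frakT ^^ j) g $ m = (1 - of_nat m) ^ j * (f $ m - g $ m)"
  using assms(4)
proof (induction j arbitrary: m)
  case (Suc j)
  have "(frakT ^^ j) f $ l = (frakT ^^ j) g $ l" if "l < n" for l
    using Suc.IH[of l] assms(3)[of l] that by simp
  from frakT_nth_diff[OF frakT_funpow_in_tangent_to_id[OF assms(1)]
      frakT_funpow_in_tangent_to_id[OF assms(2)] this Suc.prems]
  show ?case
    using Suc.IH[OF Suc.prems] by simp
qed simp

lemma frakT_funpow_fixed_unique: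
  assumes "f \<in> tangent_to_id" and "g \<in> tangent_to_id"
    and "(frakT ^^ j) f = f" and "(frakT ^^ j) g = g" and "j > 0"
    and "f $ 2 = g $ 2"
  shows "f = g"
proof (rule fps_ext)
  fix n
  show "f $ n = g $ n"
  proof (induction n rule: less_induct)
    case (less n)
    \<comment> \<open>Degrees 0 and 1 are prescribed by \<open>tangent_to_id\<close>. In degree 2
      the factor is \<open>(-1) ^ j\<close>, which is 1 for even \<open>j\<close>, so equality there
      has to be assumed.\<close>
    consider "n = 0" | "n = 1" | "n = 2" | "n \<ge> 3" by linarith
    then show ?case
    proof cases
      case 4
      have "norm (1 - of_nat n :: complex) = real n - 1"
      proof -
        have "(1 - of_nat n :: complex) = of_real (1 - real n)" by simp
        then show ?thesis using 4 by (simp only: norm_of_real)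
      qed
      then have "norm ((1 - of_nat n :: complex) ^ j) > 1"
        using 4 assms(5) by (simp add: norm_power one_less_power)
      then have "(1 - of_nat n :: complex) ^ j \<noteq> 1" by auto
      moreover have "f $ n - g $ n = (1 - of_nat n) ^ j * (f $ n - g $ n)"
        using frakT_funpow_nth_diff[OF assms(1,2), of n n j] less assms(3,4) by simp
      ultimately show ?thesis by simp
    qed (use assms in \<open>auto simp: tangent_to_id_def\<close>)
  qed
qed

text \<open>The convention \<open>0 ^ 0 = 1\<close> makes the formula cover \<open>p = 0\<close> as
  well.\<close>

lemma exp_series_nth:
  assumes "n > 0"
  shows "exp_series p $ n = p ^ (n - 1) / fact n"
  using assms
  by (cases n) (auto simp: exp_series_def fps_divide_unit fps_const_inverse power_0_left
      simp del: fact_Suc)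

lemma exp_series_nth_0: "exp_series p $ 0 = 0"
  by (simp add: exp_series_def fps_divide_unit)

lemma exp_series_in_tangent_to_id: "exp_series p \<in> tangent_to_id"
  by (simp add: tangent_to_id_def exp_series_nth exp_series_nth_0)

lemma fps_deriv_exp_series: "fps_deriv (exp_series p) = fps_exp p"
  by (rule fps_ext) (simp add: exp_series_nth field_simps del: of_nat_Suc)

text \<open>For nonzero \<open>p\<close>, dividing \<open>(exp(px) - 1) / p\<close> by its
  derivative \<open>exp(px)\<close> leaves \<open>(1 - exp(-px)) / p\<close>.\<close>

lemma frakT_exp_series: "frakT (exp_series p) = exp_series (- p)"
proof (rule frakT_unique[OF exp_series_in_tangent_to_id])
  have "fps_exp (- p) * fps_exp p = 1"
    by (simp flip: fps_exp_add_mult)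
  then show "exp_series (- p) * fps_deriv (exp_series p) = exp_series p"
    unfolding fps_deriv_exp_series
    by (auto simp: exp_series_def fps_divide_unit fps_const_inverse algebra_simps
        simp flip: fps_const_neg)
qed

lemma frakT_funpow_even_exp_series: "(frakT ^^ (2 * k)) (exp_series p) = exp_series p"
  by (induction k) (auto simp: frakT_exp_series)

lemma frakT_funpow_even_fixed:
  assumes "k \<ge> 1" and "f \<in> tangent_to_id" and "(frakT ^^ (2 * k)) f = f"
  shows "f = exp_series (2 * f $ 2)"
proof (rule frakT_funpow_fixed_unique[OF assms(2) exp_series_in_tangent_to_id assms(3)])
  show "f $ 2 = exp_series (2 * f $ 2) $ 2"
    by (simp add: exp_series_nth)
qed (use assms(1) frakT_funpow_even_exp_series in auto)

theorem theorem5p1: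
  fixes k :: nat and f :: "complex fps"
  assumes "k \<ge> 1" and "f \<in> tangent_to_id"
  shows "((frakT ^^ (2 * k)) f = f \<longrightarrow>
            (frakT ^^ 2) f = f \<and> (\<exists>p. f = exp_series p))
       \<and> ((frakT ^^ (2 * k + 1)) f = f \<longrightarrow>
            frakT f = f \<and> f = fps_X)"
proof (intro conjI impI)
  assume "(frakT ^^ (2 * k)) f = f"
  from frakT_funpow_even_fixed[OF assms this] obtain p where p: "f = exp_series p" ..
  then show "\<exists>p. f = exp_series p" ..
  show "(frakT ^^ 2) f = f"
    using frakT_funpow_even_exp_series[of 1 p] p by simp
next
  assume fixed: "(frakT ^^ (2 * k + 1)) f = f"
  \<comment> \<open>Doubling the odd period makes it even, so the even case applies.\<close>
  have "(frakT ^^ (2 * (2 * k + 1))) f = f"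
    by (simp only: mult_2[of "2 * k + 1"] funpow_add[of "2 * k + 1" "2 * k + 1"] comp_apply fixed)
  from frakT_funpow_even_fixed[OF _ assms(2) this] obtain p where p: "f = exp_series p"
    by auto
  \<comment> \<open>The first \<open>2 * k\<close> applications restore \<open>exp_series p\<close>;
    the remaining one flips the sign of \<open>p\<close>.\<close>
  have "exp_series (- p) = exp_series p"
    using fixed p frakT_funpow_even_exp_series[of k p] by (simp add: frakT_exp_series)
  then have "exp_series (- p) $ 2 = exp_series p $ 2" by simp
  then have "p = 0" by (simp add: exp_series_nth)
  then show "f = fps_X" and "frakT f = f"
    using p frakT_exp_series[of p] by (simp_all add: exp_series_def)
qed

end
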